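(* Let $E$ be a real Banach space partially ordered by a cone $K$. Let $A\colon K\to K$ be a monotone and continuous operator, and let the cone $K$ be normal. Suppose that there exist numbers $r_1\in(0,1)$, $r_2\in(1,+\infty)$, $n_0\in\mathbb{N}$ and an element $v_0\in K$, $v_0\neq\theta$, such that $$r_1A^{n_0-1}v_0\le A^{n_0}v_0\le r_2A^{n_0-1}v_0 .$$ If the operator $A$ is strongly concave, with a concave mapping $\varphi$, on $$K_1:=\langle \tau_1A^{n_0-1}v_0,\ \delta_1A^{n_0-1}v_0\rangle\subset K,$$ where $\tau_1\in(0,r_1)$ and $\delta_1\in(r_2,+\infty)$ are the unique solutions of the equations $\varphi(\tau)=\frac{\tau}{r_1}$ (in $(0,1)$) and $\delta\,\varphi\left(\frac1\delta\right)=r_2$ (in $(1,+\infty)$), respectively, then: 1) there exists $x^*\in K$, $x^*\neq\theta$, such that $Ax^*=x^*$; 2) there exist numbers $C_*>0$ and $k_*\in(0,1)$ such that $\|A^nv_0-x^*\|\le C_*k_*^n$ for all $n=n_0,n_0+1,\ldots$.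
   Context: $E$ is a real Banach space with zero element $\theta$. A cone $K\subset E$ is a nonempty closed convex set with $tK\subset K$ for all $t\ge0$ and $K\cap(-K)=\{\theta\}$; it induces the partial order $x\le y \iff y-x\in K$. The cone $K$ is normal if there is $\delta'>0$ such that $\|e_1+e_2\|\ge\delta'$ for all $e_1,e_2\in K$ with $\|e_1\|=\|e_2\|=1$ (equivalently, there is $N>0$ such that $\theta\le x\le y$ implies $\|x\|\le N\|y\|$). For $u\le v$, the conical segment is $\langle u,v\rangle=\{x\in E: u\le x\le v\}$. An operator $A\colon K\to K$ is monotone if $x\le y$ implies $Ax\le Ay$; continuity is with respect to the norm. $A^n$ denotes the $n$-fold iterate, $A^0$ the identity, and $\mathbb{N}=\{1,2,\ldots\}$. A monotone operator $A$ is strongly concave on a subset $K_1\subseteq K$, with concave mapping $\varphi$, if $\varphi\colon[0,1]\to[0,1]$ is a continuous and monotonically increasing concave mapping with $\varphi(0)=0$, $\varphi(1)=1$, $\varphi'(+0)=+\infty$ such that $A(\sigma u)\ge\varphi(\sigma)Au$ for all $u\in K_1$, $\sigma\in[0,1]$. For such $\varphi$ the two equations in the claim have unique solutions in the indicated ranges.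
   Formalization: The formal theorem additionally assumes $A^{n_0-1}v_0\neq\theta$; without it the claim fails for $n_0\ge2$ (e.g. $A=0$ on $[0,\infty)$, $v_0=1$, $n_0=2$), since then $A^nv_0=\theta$ for all $n\ge n_0$, contradicting $x^*\ne\theta$. *)

theory Defs
  imports "HOL-Analysis.Analysis"
begin

(* The library's convex_cone covers: nonempty, convex, closed under scaling by t >= 0. *)
definition order_cone :: "'a::real_normed_vector set \<Rightarrow> bool" where
  "order_cone K \<longleftrightarrow> convex_cone K \<and> closed K \<and> K \<inter> uminus ` K = {0}"

definition cone_le :: "'a::real_normed_vector set \<Rightarrow> 'a \<Rightarrow> 'a \<Rightarrow> bool" where
  "cone_le K x y \<longleftrightarrow> y - x \<in> K"

definition normal_cone :: "'a::real_normed_vector set \<Rightarrow> bool" where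
  "normal_cone K \<longleftrightarrow>
     (\<exists>d>0. \<forall>x\<in>K. \<forall>y\<in>K. norm x = 1 \<longrightarrow> norm y = 1 \<longrightarrow> d \<le> norm (x + y))"

definition conical_segment :: "'a::real_normed_vector set \<Rightarrow> 'a \<Rightarrow> 'a \<Rightarrow> 'a set" where
  "conical_segment K u v = {x. cone_le K u x \<and> cone_le K x v}"

definition monotone_operator :: "'a::real_normed_vector set \<Rightarrow> ('a \<Rightarrow> 'a) \<Rightarrow> bool" where
  "monotone_operator K A \<longleftrightarrow> monotone_on K (cone_le K) (cone_le K) A"

(* The last conjunct is phi'(+0) = +infinity, as the limit of difference quotients at 0.
   "Increasing" is meant in the non-strict sense. Only values on [0,1] matter. *)
definition concave_mapping :: "(real \<Rightarrow> real) \<Rightarrow> bool" where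
  "concave_mapping \<phi> \<longleftrightarrow>
     \<phi> ` {0..1} \<subseteq> {0..1} \<and> continuous_on {0..1} \<phi> \<and> mono_on {0..1} \<phi> \<and>
     concave_on {0..1} \<phi> \<and> \<phi> 0 = 0 \<and> \<phi> 1 = 1 \<and>
     filterlim (\<lambda>t. (\<phi> t - \<phi> 0) / (t - 0)) at_top (at_right 0)"

(* The point sigma * u need not belong to K1. *)
definition strongly_concave_on ::
  "'a::real_normed_vector set \<Rightarrow> 'a set \<Rightarrow> ('a \<Rightarrow> 'a) \<Rightarrow> (real \<Rightarrow> real) \<Rightarrow> bool" where
  "strongly_concave_on K K1 A \<phi> \<longleftrightarrow>
     K1 \<subseteq> K \<and> monotone_operator K A \<and> concave_mapping \<phi> \<and>
     (\<forall>u\<in>K1. \<forall>\<sigma>\<in>{0..1}. cone_le K (\<phi> \<sigma> *\<^sub>R A u) (A (\<sigma> *\<^sub>R u)))"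

end

theory Submission
  imports Defs
begin

text \<open>
  Put \<open>w = A\<^sup>m v\<^sub>0\<close> with \<open>m = n\<^sub>0 - 1\<close>. The equations for \<open>\<tau>\<^sub>1\<close> and \<open>\<delta>\<^sub>1\<close> are exactly what
  turns the two-sided bound \<open>r\<^sub>1 w \<le> A w \<le> r\<^sub>2 w\<close> into a sub- and a supersolution:
  with \<open>p = \<tau>\<^sub>1 w\<close> and \<open>q = \<delta>\<^sub>1 w\<close>, strong concavity gives \<open>p \<le> A p\<close> and \<open>A q \<le> q\<close>. So \<open>A\<close> maps
  the segment \<open>\<langle>p, q\<rangle>\<close> into itself, \<open>A\<^sup>n p\<close> increases, \<open>A\<^sup>n q\<close> decreases, and the iterates
  of any \<open>z \<in> \<langle>p, q\<rangle>\<close>, in particular of \<open>w\<close>, stay between the two.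

  The two monotone sequences approach each other at a geometric rate. If
  \<open>s A\<^sup>n q \<le> A\<^sup>n p\<close>, then one more application of \<open>A\<close> improves the factor \<open>s\<close> to \<open>\<phi> s\<close>. The
  infinite slope of \<open>\<phi>\<close> at \<open>0\<close> and its concavity force \<open>\<phi> s > s\<close> inside the unit interval,
  and the chord of \<open>\<phi>\<close> from \<open>s\<^sub>0 = \<tau>\<^sub>1 / \<delta>\<^sub>1\<close> to \<open>1\<close> yields a constant \<open>k < 1\<close> with
  \<open>1 - \<phi> s \<le> k (1 - s)\<close> on \<open>[s\<^sub>0, 1]\<close> (\<open>concave_mapping_contraction\<close>). Hence
  \<open>A\<^sup>n q - A\<^sup>n p \<le> k\<^sup>n q\<close>.

  Normality of the cone converts this order estimate into a norm estimate
  (\<open>normal_cone_monotone_norm\<close>). The sequence \<open>A\<^sup>n p\<close> is therefore Cauchy, its limit is a fixed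
  point by continuity, and the same estimate bounds the distance of \<open>A\<^sup>n z\<close> from it
  (\<open>strongly_concave_fixed_point\<close>). The fixed point is nonzero because it dominates \<open>\<tau>\<^sub>1 w\<close>.
\<close>

section \<open>The order induced by a cone\<close>

lemma order_cone_zero: "0 \<in> K" if "order_cone K"
  using that by (simp add: order_cone_def convex_cone_contains_0)

lemma order_cone_add: "x + y \<in> K" if "order_cone K" "x \<in> K" "y \<in> K"
  using that by (simp add: order_cone_def convex_cone_add)

lemma order_cone_scaleR: "t *\<^sub>R x \<in> K" if "order_cone K" "x \<in> K" "0 \<le> t"
  using that by (simp add: order_cone_def convex_cone_scaleR)

lemma cone_le_refl: "cone_le K x x" if "order_cone K"
  using that by (simp add: cone_le_def order_cone_zero)

lemma cone_le_trans: "cone_le K x z" if "order_cone K" "cone_le K x y" "cone_le K y z"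
  using order_cone_add[of K "y - x" "z - y"] that by (simp add: cone_le_def)

lemma cone_le_scaleR: "cone_le K (t *\<^sub>R x) (t *\<^sub>R y)"
  if "order_cone K" "cone_le K x y" "0 \<le> t"
  using order_cone_scaleR[of K "y - x" t] that by (simp add: cone_le_def scaleR_diff_right)

lemma cone_le_scaleR_left: "cone_le K (s *\<^sub>R x) (t *\<^sub>R x)"
  if "order_cone K" "x \<in> K" "s \<le> t"
  using order_cone_scaleR[of K x "t - s"] that by (simp add: cone_le_def scaleR_diff_left)

lemma cone_le_diff_mono: "cone_le K (y - x) (v - u)"
  if "order_cone K" "cone_le K u x" "cone_le K y v"
  using order_cone_add[of K "x - u" "v - y"] that by (simp add: cone_le_def algebra_simps)

lemma cone_le_in_cone: "y \<in> K" if "order_cone K" "x \<in> K" "cone_le K x y"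
  using order_cone_add[of K x "y - x"] that by (simp add: cone_le_def)

lemma cone_le_zero_imp_eq: "x = 0" if "order_cone K" "x \<in> K" "cone_le K x 0"
proof -
  have "- x \<in> K"
    using that by (simp add: cone_le_def)
  then have "x \<in> K \<inter> uminus ` K"
    using that(2) by (force intro: image_eqI[of x uminus "- x"])
  moreover have "K \<inter> uminus ` K = {0}"
    using that(1) by (simp add: order_cone_def)
  ultimately show ?thesis
    by blast
qed

lemma cone_le_limit_right: "cone_le K u l"
  if "order_cone K" "X \<longlonglongrightarrow> l" "\<forall>\<^sub>F n in sequentially. cone_le K u (X n)"
proof -
  have "(\<lambda>n. X n - u) \<longlonglongrightarrow> l - u"
    using that(2) by (intro tendsto_intros)
  moreover have "closed K"
    using that(1) by (simp add: order_cone_def)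
  ultimately show ?thesis
    using that(3) Lim_in_closed_set[of K "\<lambda>n. X n - u" sequentially "l - u"]
    by (simp add: cone_le_def)
qed

lemma cone_le_limit_left: "cone_le K l u"
  if "order_cone K" "X \<longlonglongrightarrow> l" "\<forall>\<^sub>F n in sequentially. cone_le K (X n) u"
proof -
  have "(\<lambda>n. u - X n) \<longlonglongrightarrow> u - l"
    using that(2) by (intro tendsto_intros)
  moreover have "closed K"
    using that(1) by (simp add: order_cone_def)
  ultimately show ?thesis
    using that(3) Lim_in_closed_set[of K "\<lambda>n. u - X n" sequentially "u - l"]
    by (simp add: cone_le_def)
qed

text \<open>
  The angle condition in the definition of normality only concerns unit vectors. For \<open>x\<close> and
  \<open>z = y - x\<close> of different lengths, replacing \<open>z\<close> by a vector of length \<open>\<parallel>x\<parallel>\<close> changes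
  \<open>x + z\<close> by at most \<open>\<bar>\<parallel>z\<parallel> - \<parallel>x\<parallel>\<bar> \<le> \<parallel>x + z\<parallel>\<close>, which costs only a factor \<open>2\<close>.
\<close>
lemma normal_cone_monotone_norm:
  assumes "normal_cone K" "order_cone K"
  obtains N where "0 < N"
    and "\<And>x y. x \<in> K \<Longrightarrow> cone_le K x y \<Longrightarrow> norm x \<le> N * norm y"
proof -
  obtain d where d: "0 < d"
    "\<And>x y. x \<in> K \<Longrightarrow> y \<in> K \<Longrightarrow> norm x = 1 \<Longrightarrow> norm y = 1 \<Longrightarrow> d \<le> norm (x + y)"
    using assms(1) unfolding normal_cone_def by metis
  have bound: "norm x \<le> max 1 (2 / d) * norm y" if x: "x \<in> K" and xy: "cone_le K x y" for x y
  proof -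
    define z where "z = y - x"
    have z: "z \<in> K" "y = x + z"
      using xy by (auto simp: z_def cone_le_def)
    show ?thesis
    proof (cases "x = 0 \<or> z = 0")
      case True
      then show ?thesis
        using z by (auto simp: mult_le_cancel_right1)
    next
      case False
      define e f where "e = (1 / norm x) *\<^sub>R x" and "f = (1 / norm z) *\<^sub>R z"
      have ef: "e \<in> K" "f \<in> K" "norm e = 1" "norm f = 1"
        using False x z(1) assms(2) by (auto simp: e_def f_def order_cone_scaleR)
      have y_eq: "y + (norm x - norm z) *\<^sub>R f = norm x *\<^sub>R (e + f)"
        using False z by (simp add: e_def f_def algebra_simps)
      have "norm x * d \<le> norm (norm x *\<^sub>R (e + f))"
        using d(2)[OF ef] by (simp add: mult_left_mono)
      also have "\<dots> \<le> norm y + \<bar>norm x - norm z\<bar>"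
        unfolding y_eq[symmetric] using norm_triangle_ineq[of y "(norm x - norm z) *\<^sub>R f"] ef
        by simp
      also have "\<dots> \<le> 2 * norm y"
        using norm_triangle_ineq3[of x "- z"] z(2) by simp
      finally have "norm x \<le> 2 / d * norm y"
        using d(1) by (simp add: field_simps)
      also have "\<dots> \<le> max 1 (2 / d) * norm y"
        by (intro mult_right_mono) auto
      finally show ?thesis .
    qed
  qed
  show thesis
  proof (rule that[of "max 1 (2 / d)"])
    show "0 < max 1 (2 / d)"
      by simp
  qed (fact bound)
qed

section \<open>Concave mappings as contractions towards 1\<close>

text \<open>
  Near \<open>0\<close> the graph lies above the diagonal because the slope there is infinite; a chord from
  such a point to \<open>(1, 1)\<close> lies above the diagonal as well.
\<close>
lemma concave_mapping_above_diagonal: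
  assumes "concave_mapping \<phi>" "0 < s" "s < 1"
  shows "s < \<phi> s"
proof -
  have lim: "filterlim (\<lambda>t. (\<phi> t - \<phi> 0) / (t - 0)) at_top (at_right 0)"
    and conc: "concave_on {0..1} \<phi>" and ends: "\<phi> 0 = 0" "\<phi> 1 = 1"
    using assms(1) by (auto simp: concave_mapping_def)
  have "\<forall>\<^sub>F t in at_right 0. 1 < \<phi> t / t"
    using lim ends by (simp add: filterlim_at_top_dense)
  moreover have "\<forall>\<^sub>F t in at_right 0. 0 < t \<and> t < s"
    using assms(2) by (auto simp: eventually_at_right[of 0 1])
  ultimately have "\<forall>\<^sub>F t in at_right 0. 1 < \<phi> t / t \<and> 0 < t \<and> t < s"
    by eventually_elim auto
  then obtain t where t: "1 < \<phi> t / t" "0 < t" "t < s"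
    using eventually_happens[of _ "at_right (0::real)"] trivial_limit_at_right_real by blast
  define \<mu> where "\<mu> = (s - t) / (1 - t)"
  have \<mu>: "0 \<le> \<mu>" "\<mu> < 1"
    using t assms(3) by (auto simp: \<mu>_def)
  have "\<mu> * (1 - t) = s - t"
    using t assms(3) by (simp add: \<mu>_def)
  then have s: "s = (1 - \<mu>) * t + \<mu> * 1"
    by (simp add: algebra_simps)
  have "t < \<phi> t"
    using t by (simp add: field_simps)
  then have "s < (1 - \<mu>) * \<phi> t + \<mu> * \<phi> 1"
    using \<mu> ends by (subst s) simp
  also have "\<dots> \<le> \<phi> ((1 - \<mu>) *\<^sub>R t + \<mu> *\<^sub>R 1)"
    using t assms(3) \<mu> by (intro concave_onD[OF conc]) auto
  also have "\<dots> = \<phi> s"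
    using s by simp
  finally show ?thesis .
qed

lemma concave_mapping_contraction:
  assumes "concave_mapping \<phi>" "0 < s\<^sub>0" "s\<^sub>0 < 1"
  obtains k where "0 < k" "k < 1" "\<And>s. s\<^sub>0 \<le> s \<Longrightarrow> s \<le> 1 \<Longrightarrow> 1 - \<phi> s \<le> k * (1 - s)"
proof -
  have conc: "concave_on {0..1} \<phi>" and end1: "\<phi> 1 = 1"
    using assms(1) by (auto simp: concave_mapping_def)
  define c where "c = (1 - \<phi> s\<^sub>0) / (1 - s\<^sub>0)"
  have "c < 1"
    using concave_mapping_above_diagonal[OF assms] assms(3) by (simp add: c_def)
  have chord: "1 - \<phi> s \<le> c * (1 - s)" if s: "s\<^sub>0 \<le> s" "s \<le> 1" for s
  proof -
    define \<mu> where "\<mu> = (s - s\<^sub>0) / (1 - s\<^sub>0)"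
    have \<mu>: "0 \<le> \<mu>" "\<mu> \<le> 1"
      using s assms(3) by (auto simp: \<mu>_def)
    have "\<mu> * (1 - s\<^sub>0) = s - s\<^sub>0"
      using assms(3) by (simp add: \<mu>_def)
    then have s_eq: "(1 - \<mu>) *\<^sub>R s\<^sub>0 + \<mu> *\<^sub>R 1 = s"
      by (simp add: algebra_simps)
    have "(1 - \<mu>) * \<phi> s\<^sub>0 + \<mu> * \<phi> 1 \<le> \<phi> ((1 - \<mu>) *\<^sub>R s\<^sub>0 + \<mu> *\<^sub>R 1)"
      using assms(2,3) \<mu> by (intro concave_onD[OF conc]) auto
    then have "1 - \<phi> s \<le> (1 - \<mu>) * (1 - \<phi> s\<^sub>0)"
      unfolding s_eq end1 by (simp add: algebra_simps)
    also have "1 - \<mu> = (1 - s) / (1 - s\<^sub>0)"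
      using assms(3) by (simp add: \<mu>_def field_simps)
    finally show ?thesis
      by (simp add: c_def mult.commute)
  qed
  \<comment> \<open>The slope \<open>c\<close> vanishes when \<open>\<phi>\<close> already reaches \<open>1\<close> at \<open>s\<^sub>0\<close>; the maximum keeps \<open>k\<close> positive.\<close>
  show thesis
  proof (rule that[of "max c (1 / 2)"])
    fix s assume s: "s\<^sub>0 \<le> s" "s \<le> 1"
    have "c * (1 - s) \<le> max c (1 / 2) * (1 - s)"
      using s by (intro mult_right_mono) auto
    with chord[OF s] show "1 - \<phi> s \<le> max c (1 / 2) * (1 - s)"
      by linarith
  qed (use \<open>c < 1\<close> in auto)
qed

section \<open>Iteration between a sub- and a supersolution\<close>

lemma funpow_in_invariant_set: "(f ^^ n) x \<in> S" if "f ` S \<subseteq> S" "x \<in> S"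
  using that by (induction n) auto

lemma funpow_in_segment:
  assumes K: "order_cone K" and mono: "monotone_operator K A"
    and pq: "p \<in> K" "cone_le K p (A p)" "cone_le K (A q) q"
    and x: "x \<in> conical_segment K p q"
  shows "(A ^^ n) x \<in> conical_segment K p q"
proof (induction n)
  case 0
  then show ?case using x by simp
next
  case (Suc n)
  let ?z = "(A ^^ n) x"
  have z: "cone_le K p ?z" "cone_le K ?z q"
    using Suc by (auto simp: conical_segment_def)
  then have "?z \<in> K" "q \<in> K"
    using K pq(1) cone_le_in_cone by blast+
  then have "cone_le K (A p) (A ?z)" "cone_le K (A ?z) (A q)"
    using mono z pq(1) unfolding monotone_operator_def by (auto intro: monotone_onD)
  then show ?case
    using K pq(2,3) cone_le_trans by (auto simp: conical_segment_def)
qed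

lemma funpow_cone_mono:
  assumes mono: "monotone_operator K A" and "A ` K \<subseteq> K"
    and "x \<in> K" "y \<in> K" "cone_le K x y"
  shows "cone_le K ((A ^^ n) x) ((A ^^ n) y)"
proof (induction n)
  case 0
  then show ?case using assms by simp
next
  case (Suc n)
  then show ?case
    using funpow_in_invariant_set[OF assms(2)] mono assms(3,4) unfolding monotone_operator_def by (auto intro: monotone_onD)
qed

text \<open>
  The factor \<open>1 - (1 - s\<^sub>0) k\<^sup>n\<close> is a lower bound for the \<open>n\<close>-th iterate of \<open>\<phi>\<close> at \<open>s\<^sub>0\<close>;
  applying \<open>A\<close> to \<open>s A\<^sup>n q \<le> A\<^sup>n p\<close> replaces the factor \<open>s\<close> by \<open>\<phi> s\<close>.
\<close>
lemma strongly_concave_iterates_ratio: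
  assumes K: "order_cone K" and A: "A ` K \<subseteq> K"
    and sc: "strongly_concave_on K (conical_segment K p q) A \<phi>"
    and pq: "p \<in> K" "cone_le K p q" "cone_le K p (A p)" "cone_le K (A q) q"
    and s\<^sub>0: "0 < s\<^sub>0" "s\<^sub>0 < 1" "cone_le K (s\<^sub>0 *\<^sub>R q) p"
    and k: "0 < k" "k < 1" "\<And>s. s\<^sub>0 \<le> s \<Longrightarrow> s \<le> 1 \<Longrightarrow> 1 - \<phi> s \<le> k * (1 - s)"
  shows "cone_le K ((1 - (1 - s\<^sub>0) * k ^ n) *\<^sub>R (A ^^ n) q) ((A ^^ n) p)"
proof (induction n)
  case 0
  then show ?case using s\<^sub>0 by simp
next
  case (Suc n)
  define s where "s = 1 - (1 - s\<^sub>0) * k ^ n"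
  have mono: "monotone_operator K A"
    using sc by (simp add: strongly_concave_on_def)
  have "(1 - s\<^sub>0) * k ^ n \<le> 1 - s\<^sub>0"
    using k s\<^sub>0 by (intro mult_left_le power_le_one) auto
  then have "s\<^sub>0 \<le> s"
    unfolding s_def by linarith
  moreover have "s \<le> 1"
    using s\<^sub>0 k by (simp add: s_def)
  ultimately have s: "s\<^sub>0 \<le> s" "s \<le> 1"
    by auto
  note inK = funpow_in_invariant_set[OF A]
  have "q \<in> K"
    using K pq cone_le_in_cone by blast
  have "q \<in> conical_segment K p q"
    using pq K by (simp add: conical_segment_def cone_le_refl)
  then have "(A ^^ n) q \<in> conical_segment K p q"
    using funpow_in_segment[OF K mono pq(1,3,4)] by blast
  then have "cone_le K (\<phi> s *\<^sub>R A ((A ^^ n) q)) (A (s *\<^sub>R (A ^^ n) q))"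
    using sc s s\<^sub>0 by (simp add: strongly_concave_on_def)
  moreover have "cone_le K (A (s *\<^sub>R (A ^^ n) q)) (A ((A ^^ n) p))"
  proof (rule monotone_onD[OF mono[unfolded monotone_operator_def]])
    show "s *\<^sub>R (A ^^ n) q \<in> K"
      using K inK[OF \<open>q \<in> K\<close>] s s\<^sub>0 by (intro order_cone_scaleR) auto
  qed (use inK[OF pq(1)] Suc in \<open>simp_all add: s_def\<close>)
  moreover have "1 - (1 - s\<^sub>0) * k ^ Suc n \<le> \<phi> s"
    using k(3)[OF s] by (simp add: s_def mult_ac)
  then have "cone_le K ((1 - (1 - s\<^sub>0) * k ^ Suc n) *\<^sub>R A ((A ^^ n) q)) (\<phi> s *\<^sub>R A ((A ^^ n) q))"
    using inK[OF \<open>q \<in> K\<close>, of "Suc n"] K by (intro cone_le_scaleR_left) auto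
  ultimately have "cone_le K ((1 - (1 - s\<^sub>0) * k ^ Suc n) *\<^sub>R A ((A ^^ n) q)) (A ((A ^^ n) p))"
    by (meson K cone_le_trans)
  then show ?case
    by simp
qed

text \<open>
  All iterates from the segment lie in the shrinking segments \<open>\<langle>A\<^sup>n p, A\<^sup>n q\<rangle>\<close>, whose
  norm diameter is of order \<open>k\<^sup>n\<close>; their common point is the fixed point. The comparison
  \<open>s\<^sub>0 q \<le> p\<close> starts the estimate of the ratio of the two end points.
\<close>
lemma strongly_concave_fixed_point:
  fixes K :: "'a::banach set"
  assumes K: "order_cone K" and "normal_cone K" and A: "A ` K \<subseteq> K" and cont: "continuous_on K A"
    and sc: "strongly_concave_on K (conical_segment K p q) A \<phi>"
    and pq: "p \<in> K" "cone_le K p q" "cone_le K p (A p)" "cone_le K (A q) q"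
    and s\<^sub>0: "0 < s\<^sub>0" "s\<^sub>0 < 1" "cone_le K (s\<^sub>0 *\<^sub>R q) p"
  obtains x C k where "x \<in> conical_segment K p q" "A x = x" "0 < C" "0 < k" "k < 1"
    "\<And>z n. z \<in> conical_segment K p q \<Longrightarrow> norm ((A ^^ n) z - x) \<le> C * k ^ n"
proof -
  obtain k where k: "0 < k" "k < 1" "\<And>s. s\<^sub>0 \<le> s \<Longrightarrow> s \<le> 1 \<Longrightarrow> 1 - \<phi> s \<le> k * (1 - s)"
    using concave_mapping_contraction[of \<phi> s\<^sub>0] sc s\<^sub>0 by (auto simp: strongly_concave_on_def)
  obtain N where N: "0 < N" "\<And>x y. x \<in> K \<Longrightarrow> cone_le K x y \<Longrightarrow> norm x \<le> N * norm y"
    using normal_cone_monotone_norm[OF assms(2) K] by blast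
  have mono: "monotone_operator K A"
    using sc by (simp add: strongly_concave_on_def)
  note in_seg = funpow_in_segment[OF K mono pq(1,3,4)]
  have seg_K: "z \<in> K" if "z \<in> conical_segment K p q" for z
    using that pq(1) K cone_le_in_cone by (auto simp: conical_segment_def)
  have ends: "p \<in> conical_segment K p q" "q \<in> conical_segment K p q"
    using pq(2) K by (auto simp: conical_segment_def cone_le_refl)
  have "q \<in> K"
    using ends seg_K by blast
  define X Y where "X n = (A ^^ n) p" and "Y n = (A ^^ n) q" for n
  have between: "cone_le K (X n) ((A ^^ n) z)" "cone_le K ((A ^^ n) z) (Y n)"
    if "z \<in> conical_segment K p q" for z n
    unfolding X_def Y_def
    using that seg_K[OF that] pq(1) \<open>q \<in> K\<close> funpow_cone_mono[OF mono A]
    by (auto simp: conical_segment_def)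
  have gap: "cone_le K (Y n - X n) (k ^ n *\<^sub>R q)" for n
  proof -
    let ?c = "(1 - s\<^sub>0) * k ^ n"
    have "cone_le K ((1 - ?c) *\<^sub>R Y n) (X n)"
      unfolding X_def Y_def by (rule strongly_concave_iterates_ratio[OF K A sc pq s\<^sub>0 k])
    then have "cone_le K (Y n - X n) (?c *\<^sub>R Y n)"
      by (simp add: cone_le_def algebra_simps)
    moreover have "cone_le K (?c *\<^sub>R Y n) (?c *\<^sub>R q)"
      using in_seg[OF ends(2), of n] s\<^sub>0 k K
      by (intro cone_le_scaleR) (auto simp: Y_def conical_segment_def)
    moreover have "cone_le K (?c *\<^sub>R q) (k ^ n *\<^sub>R q)"
      using s\<^sub>0 k K \<open>q \<in> K\<close> by (intro cone_le_scaleR_left) auto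
    ultimately show ?thesis
      using K cone_le_trans by blast
  qed
  define M where "M = N * norm q"
  have near: "norm (y - X n) \<le> M * k ^ n" if "cone_le K (X n) y" "cone_le K y (Y n)" for y n
  proof -
    have "cone_le K (y - X n) (Y n - X n)"
      using that K by (intro cone_le_diff_mono cone_le_refl)
    then have "cone_le K (y - X n) (k ^ n *\<^sub>R q)"
      using gap K cone_le_trans by blast
    moreover have "y - X n \<in> K"
      using that(1) by (simp add: cone_le_def)
    ultimately have "norm (y - X n) \<le> N * norm (k ^ n *\<^sub>R q)"
      by (intro N(2))
    then show ?thesis
      using k(1) by (simp add: M_def mult_ac)
  qed
  have tail: "cone_le K (X n) (X m)" "cone_le K (X m) (Y n)" if "n \<le> m" for m n
  proof -
    obtain j where "m = n + j"
      using \<open>n \<le> m\<close> le_Suc_ex by blast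
    then have "X m = (A ^^ n) (X j)"
      by (simp add: X_def funpow_add)
    then show "cone_le K (X n) (X m)" "cone_le K (X m) (Y n)"
      using between[of "X j" n] in_seg[OF ends(1), of j] by (simp_all add: X_def)
  qed
  have null: "(\<lambda>n. M * k ^ n) \<longlonglongrightarrow> 0"
    using k by (intro tendsto_mult_right_zero LIMSEQ_power_zero) auto
  have "Cauchy X"
  proof (rule metric_CauchyI)
    fix e :: real assume "0 < e"
    then obtain n where n: "M * k ^ n < e / 2"
      using order_tendstoD(2)[OF null, of "e / 2"] by (auto simp: eventually_sequentially)
    have "dist (X i) (X j) < e" if "n \<le> i" "n \<le> j" for i j
    proof -
      have "dist (X i) (X n) < e / 2" "dist (X j) (X n) < e / 2"
        using near[OF tail[OF that(1)]] near[OF tail[OF that(2)]] n by (auto simp: dist_norm)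
      then show ?thesis
        by (rule dist_triangle_half_l[of _ "X n"])
    qed
    then show "\<exists>n. \<forall>i\<ge>n. \<forall>j\<ge>n. dist (X i) (X j) < e"
      by blast
  qed
  then obtain x where x: "X \<longlonglongrightarrow> x"
    using Cauchy_convergent convergent_def by blast
  have trapped: "cone_le K (X n) x" "cone_le K x (Y n)" for n
  proof -
    show "cone_le K (X n) x"
      by (rule cone_le_limit_right[OF K x]) (rule eventually_sequentiallyI[OF tail(1)])
    show "cone_le K x (Y n)"
      by (rule cone_le_limit_left[OF K x]) (rule eventually_sequentiallyI[OF tail(2)])
  qed
  have x_seg: "x \<in> conical_segment K p q"
    using trapped[of 0] by (simp add: conical_segment_def X_def Y_def)
  have "(\<lambda>n. A (X n)) \<longlonglongrightarrow> A x"
    using cont x seg_K[OF x_seg] seg_K[OF in_seg[OF ends(1)]]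
    by (intro continuous_on_tendsto_compose[OF cont x]) (auto simp: X_def)
  moreover have "(\<lambda>n. A (X n)) \<longlonglongrightarrow> x"
    using LIMSEQ_Suc[OF x] by (simp add: X_def)
  ultimately have fixed: "A x = x"
    by (rule LIMSEQ_unique)
  \<comment> \<open>Adding \<open>1\<close> keeps the constant positive even in the degenerate case \<open>q = 0\<close>.\<close>
  have bound: "norm ((A ^^ n) z - x) \<le> (2 * M + 1) * k ^ n"
    if "z \<in> conical_segment K p q" for z n
  proof -
    have "norm ((A ^^ n) z - x) \<le> norm ((A ^^ n) z - X n) + norm (x - X n)"
      using norm_triangle_ineq4[of "(A ^^ n) z - X n" "x - X n"] by simp
    also have "\<dots> \<le> M * k ^ n + M * k ^ n"
      by (intro add_mono near between that trapped)
    also have "\<dots> \<le> (2 * M + 1) * k ^ n"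
      using k(1) by (simp add: algebra_simps)
    finally show ?thesis .
  qed
  have "0 < 2 * M + 1"
    using N(1) by (simp add: M_def add_nonneg_pos)
  then show thesis
    using that x_seg fixed k bound by blast
qed

section \<open>The fixed point theorem\<close>

theorem theorem3:
  fixes K :: "'a::banach set" and A :: "'a \<Rightarrow> 'a" and \<phi> :: "real \<Rightarrow> real"
    and r\<^sub>1 r\<^sub>2 \<tau>\<^sub>1 \<delta>\<^sub>1 :: real and n\<^sub>0 :: nat and v\<^sub>0 :: 'a
  assumes "order_cone K" and "normal_cone K"
    and "A ` K \<subseteq> K" and "monotone_operator K A" and "continuous_on K A"
    and "0 < r\<^sub>1" and "r\<^sub>1 < 1" and "1 < r\<^sub>2" and "1 \<le> n\<^sub>0"
    and "v\<^sub>0 \<in> K" and "v\<^sub>0 \<noteq> 0" and "(A ^^ (n\<^sub>0 - 1)) v\<^sub>0 \<noteq> 0"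
    and "cone_le K (r\<^sub>1 *\<^sub>R (A ^^ (n\<^sub>0 - 1)) v\<^sub>0) ((A ^^ n\<^sub>0) v\<^sub>0)"
    and "cone_le K ((A ^^ n\<^sub>0) v\<^sub>0) (r\<^sub>2 *\<^sub>R (A ^^ (n\<^sub>0 - 1)) v\<^sub>0)"
    and "0 < \<tau>\<^sub>1" and "\<tau>\<^sub>1 < 1" and "\<phi> \<tau>\<^sub>1 = \<tau>\<^sub>1 / r\<^sub>1"
    and "1 < \<delta>\<^sub>1" and "\<delta>\<^sub>1 * \<phi> (1 / \<delta>\<^sub>1) = r\<^sub>2"
    and "strongly_concave_on K
           (conical_segment K (\<tau>\<^sub>1 *\<^sub>R (A ^^ (n\<^sub>0 - 1)) v\<^sub>0) (\<delta>\<^sub>1 *\<^sub>R (A ^^ (n\<^sub>0 - 1)) v\<^sub>0)) A \<phi>"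
  shows "\<exists>x\<in>K. x \<noteq> 0 \<and> A x = x \<and>
           (\<exists>C k. 0 < C \<and> 0 < k \<and> k < 1 \<and>
              (\<forall>n\<ge>n\<^sub>0. norm ((A ^^ n) v\<^sub>0 - x) \<le> C * k ^ n))"
proof -
  note K = assms(1)
  define w where "w = (A ^^ (n\<^sub>0 - 1)) v\<^sub>0"
  have Aw: "(A ^^ n\<^sub>0) v\<^sub>0 = A w"
    using \<open>1 \<le> n\<^sub>0\<close> by (cases n\<^sub>0) (auto simp: w_def)
  have "w \<noteq> 0"
    using assms(12) by (simp add: w_def)
  have lower: "cone_le K (r\<^sub>1 *\<^sub>R w) (A w)" and upper: "cone_le K (A w) (r\<^sub>2 *\<^sub>R w)"
    using assms(13,14) unfolding Aw w_def by auto
  define p q where "p = \<tau>\<^sub>1 *\<^sub>R w" and "q = \<delta>\<^sub>1 *\<^sub>R w"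
  have sc: "strongly_concave_on K (conical_segment K p q) A \<phi>"
    using assms(20) by (simp add: p_def q_def w_def)
  have "w \<in> K"
    using assms(3,10) by (simp add: w_def funpow_in_invariant_set)
  note scale_w = cone_le_scaleR_left[OF K \<open>w \<in> K\<close>]
  have "p \<in> K"
    using \<open>w \<in> K\<close> K assms(15) by (simp add: p_def order_cone_scaleR)
  have "cone_le K p q"
    using scale_w[of \<tau>\<^sub>1 \<delta>\<^sub>1] assms(16,18) by (simp add: p_def q_def)
  have w_seg: "w \<in> conical_segment K p q"
    using scale_w[of \<tau>\<^sub>1 1] scale_w[of 1 \<delta>\<^sub>1] assms(16,18)
    by (simp add: conical_segment_def p_def q_def)
  have q_seg: "q \<in> conical_segment K p q"
    using \<open>cone_le K p q\<close> K by (simp add: conical_segment_def cone_le_refl)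
  have concave: "cone_le K (\<phi> \<sigma> *\<^sub>R A u) (A (\<sigma> *\<^sub>R u))"
    if "u \<in> conical_segment K p q" "0 \<le> \<sigma>" "\<sigma> \<le> 1" for u \<sigma>
    using sc that by (simp add: strongly_concave_on_def)
  have sub: "cone_le K p (A p)"
  proof -
    have "cone_le K (\<phi> \<tau>\<^sub>1 *\<^sub>R (r\<^sub>1 *\<^sub>R w)) (\<phi> \<tau>\<^sub>1 *\<^sub>R A w)"
      using K lower assms(6,15,17) by (intro cone_le_scaleR) auto
    moreover have "\<phi> \<tau>\<^sub>1 *\<^sub>R (r\<^sub>1 *\<^sub>R w) = p"
      using assms(6,17) by (simp add: p_def)
    moreover have "cone_le K (\<phi> \<tau>\<^sub>1 *\<^sub>R A w) (A p)"
      using concave[OF w_seg, of \<tau>\<^sub>1] assms(15,16) by (simp add: p_def)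
    ultimately show ?thesis
      using K cone_le_trans by metis
  qed
  have super: "cone_le K (A q) q"
  proof -
    define c where "c = \<phi> (1 / \<delta>\<^sub>1)"
    have c: "c = r\<^sub>2 / \<delta>\<^sub>1"
      using assms(18,19) by (simp add: c_def field_simps)
    then have "0 < c"
      using assms(8,18) by simp
    have "cone_le K (c *\<^sub>R A q) (A w)"
      using concave[OF q_seg, of "1 / \<delta>\<^sub>1"] assms(18) by (simp add: c_def q_def)
    then have "cone_le K (c *\<^sub>R A q) (r\<^sub>2 *\<^sub>R w)"
      using upper K cone_le_trans by blast
    then have "cone_le K ((1 / c) *\<^sub>R (c *\<^sub>R A q)) ((1 / c) *\<^sub>R (r\<^sub>2 *\<^sub>R w))"
      using K \<open>0 < c\<close> by (intro cone_le_scaleR) auto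
    moreover have "(1 / c) *\<^sub>R (r\<^sub>2 *\<^sub>R w) = q"
      using c assms(8,18) by (simp add: q_def)
    ultimately show ?thesis
      using \<open>0 < c\<close> by simp
  qed
  have ratio: "0 < \<tau>\<^sub>1 / \<delta>\<^sub>1" "\<tau>\<^sub>1 / \<delta>\<^sub>1 < 1" "cone_le K ((\<tau>\<^sub>1 / \<delta>\<^sub>1) *\<^sub>R q) p"
    using assms(15,16,18) K by (auto simp: p_def q_def cone_le_refl)
  obtain x C k where x: "x \<in> conical_segment K p q" "A x = x" and Ck: "0 < C" "0 < k" "k < 1"
    and bound: "\<And>z n. z \<in> conical_segment K p q \<Longrightarrow> norm ((A ^^ n) z - x) \<le> C * k ^ n"
    using strongly_concave_fixed_point[OF K assms(2,3,5) sc \<open>p \<in> K\<close> \<open>cone_le K p q\<close> sub super ratio]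
    by metis
  have "x \<in> K"
    using x(1) \<open>p \<in> K\<close> K cone_le_in_cone by (auto simp: conical_segment_def)
  moreover have "x \<noteq> 0"
    using x(1) cone_le_zero_imp_eq[OF K \<open>p \<in> K\<close>] \<open>w \<noteq> 0\<close> assms(15)
    by (auto simp: conical_segment_def p_def)
  \<comment> \<open>Counting iterations from \<open>v\<^sub>0\<close> rather than from \<open>w\<close> divides the constant by \<open>k\<close>
      to the power \<open>n\<^sub>0 - 1\<close>.\<close>
  moreover have "norm ((A ^^ n) v\<^sub>0 - x) \<le> C / k ^ (n\<^sub>0 - 1) * k ^ n" if "n\<^sub>0 \<le> n" for n
  proof -
    define j where "j = n - (n\<^sub>0 - 1)"
    have n: "n = j + (n\<^sub>0 - 1)"
      using that by (simp add: j_def)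
    have "(A ^^ n) v\<^sub>0 = (A ^^ j) w"
      unfolding n w_def by (simp add: funpow_add)
    moreover have "C * k ^ j = C / k ^ (n\<^sub>0 - 1) * k ^ n"
      unfolding n using Ck(2) by (simp add: power_add)
    ultimately show ?thesis
      using bound[OF w_seg, of j] by simp
  qed
  moreover have "0 < C / k ^ (n\<^sub>0 - 1)"
    using Ck by simp
  ultimately show ?thesis
    using x(2) Ck(2,3) by blast
qed

end
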